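(* For all integers $n\ge 3$ and $K\ge 1$, the $C_n$ snake with $K$ blocks is a difference graph.
   Context: A graph $G=(V,E)$ is a difference graph if there is a bijection $f$ from $V$ onto a set $S$ of positive integers such that for all distinct $x,y\in V$: $xy\in E$ if and only if $|f(x)-f(y)|\in S$. The $C_n$ snake with $K$ blocks is obtained from a path on $K+1$ vertices by replacing each edge by a cycle $C_n$ (consecutive cycles share exactly one vertex). Explicitly: vertices $u_0,u_1,\dots,u_{K(n-1)}$, with edges $u_iu_{i+1}$ for $0\le i<K(n-1)$ and $u_{k(n-1)}u_{(k+1)(n-1)}$ for $0\le k\le K-1$. *)

theory Defs
  imports Main
begin

text \<open>A graph is given by its vertex set and its set of undirected edges, an edge being the
  two-element set of its ends.\<close>

definition simple_graph :: "'a set \<Rightarrow> 'a set set \<Rightarrow> bool" where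
  "simple_graph V E \<longleftrightarrow> (\<forall>e\<in>E. e \<subseteq> V \<and> card e = 2)"

definition difference_graph :: "'a set \<Rightarrow> 'a set set \<Rightarrow> bool" where
  "difference_graph V E \<longleftrightarrow>
     simple_graph V E \<and>
     (\<exists>(f :: 'a \<Rightarrow> int) S. S \<subseteq> {0<..} \<and> bij_betw f V S \<and>
        (\<forall>x\<in>V. \<forall>y\<in>V. x \<noteq> y \<longrightarrow> ({x, y} \<in> E \<longleftrightarrow> \<bar>f x - f y\<bar> \<in> S)))"

text \<open>The vertex \<open>u\<^sub>i\<close> of the snake is represented by the number \<open>i\<close>. The \<open>k\<close>-th cycle
  consists of the path from \<open>k * (n - 1)\<close> to \<open>(k + 1) * (n - 1)\<close> and the chord joining its ends.\<close>

definition snake_verts :: "nat \<Rightarrow> nat \<Rightarrow> nat set" where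
  "snake_verts n K = {0..K * (n - 1)}"

definition snake_edges :: "nat \<Rightarrow> nat \<Rightarrow> nat set set" where
  "snake_edges n K =
     {{i, i + 1} | i. i < K * (n - 1)} \<union>
     {{k * (n - 1), (k + 1) * (n - 1)} | k. k < K}"

end

theory Submission
  imports Defs
begin

text \<open>Put \<open>q = 2 ^ (n - 2) + 1\<close> and label the \<open>j\<close>-th vertex of the \<open>k\<close>-th block by \<open>2 ^ j * q ^ k\<close>
  for \<open>0 \<le> j \<le> n - 2\<close>; the last vertex of the block is the first one of the next and has label
  \<open>q ^ (k + 1) = q ^ k + 2 ^ (n - 2) * q ^ k\<close>. Each edge is the difference of a doubling or
  of this relation. Conversely, let one label be the sum of two others. The powers of \<open>q\<close> in
  the two summands agree, since otherwise \<open>q\<close> would divide a power of two. Dividing by this power,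
  the sum is \<open>2 ^ c + 2 ^ e \<le> 2 ^ (n - 1) < 2 * q\<close>, so it is either a power of two and
  \<open>c = e\<close>, or it is \<open>q\<close>, and then \<open>{c, e} = {0, n - 2}\<close> by parity.\<close>

text \<open>The larger summand \<open>2 ^ e\<close> is properly below \<open>2 ^ a\<close>, so its
  double is still at most \<open>2 ^ a\<close>; hence it does not exceed the smaller
  summand.\<close>

lemma power_two_eq_sum:
  fixes a c e :: nat
  assumes "(2::nat) ^ a = 2 ^ c + 2 ^ e"
  shows "c = e \<and> a = Suc c"
proof -
  have *: "c = e \<and> a = Suc c" if "(2::nat) ^ a = 2 ^ c + 2 ^ e" "c \<le> e" for c e :: nat
  proof -
    have "(2::nat) ^ e < 2 ^ a" using that by simp
    then have "Suc e \<le> a" by simp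
    then have "(2::nat) ^ Suc e \<le> 2 ^ a" by (rule power_increasing) simp
    then have "(2::nat) ^ e \<le> 2 ^ c" using that by simp
    then have "e = c" using that by simp
    then have "(2::nat) ^ a = 2 ^ Suc c" using that by simp
    then have "a = Suc c" using power_inject_exp[of "2::nat" a "Suc c"] by simp
    then show ?thesis using \<open>e = c\<close> by simp
  qed
  show ?thesis
  proof (cases "c \<le> e")
    case True
    then show ?thesis using * assms by blast
  next
    case False
    then show ?thesis using *[of e c] assms by (simp add: add.commute)
  qed
qed

lemma power_product_eq_sum:
  fixes p q :: nat
  assumes p: "p \<ge> 1" and q: "q = 2 ^ p + 1" and "c \<le> p" "e \<le> p"
    and eq: "2 ^ a * q ^ b = 2 ^ c * q ^ d + 2 ^ e * q ^ f"
    and "a \<le> p"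
  shows "d = f \<and> (b = d \<and> c = e \<and> a = Suc c \<or>
    b = Suc d \<and> a = 0 \<and> (c = 0 \<and> e = p \<or> c = p \<and> e = 0))"
proof -
  have "odd q" using p q by simp
  have q3: "q \<ge> 3" using p q power_increasing[of 1 p "2::nat"] by simp
  have dvd: "\<not> q dvd 2 ^ m" for m
  proof
    assume "q dvd 2 ^ m"
    moreover have "coprime q (2 ^ m)" using \<open>odd q\<close> by simp
    ultimately have "q dvd 1"
      using coprime_common_divisor[of q "2 ^ m" q] by simp
    then show False using q3 by simp
  qed
  \<comment> \<open>As \<open>2 ^ a < q\<close>, the left side is below \<open>q ^ Suc b\<close>.
    The summands are kept arbitrary here and in the next step because they are exchanged
    afterwards.\<close>
  have le: "f \<le> b"
    if "2 ^ a * q ^ b = 2 ^ c * q ^ d + 2 ^ e * q ^ f" for c d e f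
  proof (rule ccontr)
    assume "\<not> f \<le> b"
    have "2 ^ a < q" using q \<open>a \<le> p\<close> by (simp add: less_Suc_eq_le)
    then have "2 ^ a * q ^ b < q * q ^ b" using q3 by (intro mult_strict_right_mono) simp_all
    also have "\<dots> = q ^ Suc b" by simp
    also have "\<dots> \<le> q ^ f" using \<open>\<not> f \<le> b\<close> q3 by (intro power_increasing) auto
    also have "\<dots> \<le> 2 ^ e * q ^ f" by simp
    finally show False using that by simp
  qed
  \<comment> \<open>If \<open>d < f\<close>, then also \<open>d < b\<close>, so
    \<open>q ^ Suc d\<close> divides two of the three terms and therefore the third,
    \<open>2 ^ c * q ^ d\<close>.\<close>
  have nless: "\<not> d < f"
    if eq: "2 ^ a * q ^ b = 2 ^ c * q ^ d + 2 ^ e * q ^ f" for c d e f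
  proof
    assume "d < f"
    have "q ^ Suc d dvd 2 ^ a * q ^ b"
      using \<open>d < f\<close> le[OF eq] by (intro dvd_mult le_imp_power_dvd) simp
    moreover have "q ^ Suc d dvd 2 ^ e * q ^ f"
      using \<open>d < f\<close> by (intro dvd_mult le_imp_power_dvd) simp
    ultimately have "q ^ Suc d dvd 2 ^ c * q ^ d"
      using eq by (metis dvd_add_left_iff)
    then have "q dvd 2 ^ c" using q3 by simp
    then show False using dvd by blast
  qed
  have "d = f" using nless[OF eq] nless[of e f c d] eq by (simp add: add.commute)
  define t where "t = b - d"
  have b: "b = d + t" using le[OF eq] \<open>d = f\<close> by (simp add: t_def)
  have "q ^ d * (2 ^ a * q ^ t) = q ^ d * (2 ^ c + 2 ^ e)"
    using eq \<open>d = f\<close> by (simp add: b power_add algebra_simps)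
  then have eq': "2 ^ a * q ^ t = 2 ^ c + 2 ^ e" using q3 by simp
  \<comment> \<open>Both summands are at most \<open>2 ^ p\<close>, which is
    \<open>q - 1\<close>.\<close>
  have lt: "2 ^ a * q ^ t < 2 * q"
    using eq' q power_increasing[OF \<open>c \<le> p\<close>, of "2::nat"] power_increasing[OF \<open>e \<le> p\<close>, of "2::nat"]
    by linarith
  show ?thesis
  proof (cases t)
    case 0
    then show ?thesis using power_two_eq_sum[of a c e] eq' b \<open>d = f\<close> by simp
  next
    case (Suc s)
    \<comment> \<open>Cancelling one factor \<open>q\<close> leaves a positive number below 2, which
      forces \<open>a = 0\<close> and \<open>s = 0\<close>.\<close>
    have lt': "2 ^ a * q ^ s < 2"
      using lt Suc q3 by (simp add: mult.left_commute mult.commute[of _ q])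
    have "a = 0"
    proof (rule ccontr)
      assume "a \<noteq> 0"
      then have "2 \<le> (2::nat) ^ a" using power_increasing[of 1 a "2::nat"] by simp
      also have "\<dots> \<le> 2 ^ a * q ^ s" using q3 by simp
      finally show False using lt' by simp
    qed
    have "s = 0"
    proof (rule ccontr)
      assume "s \<noteq> 0"
      then have "q \<le> q ^ s" using q3 by (simp add: self_le_power)
      then show False using lt' q3 \<open>a = 0\<close> by simp
    qed
    have sum: "2 ^ p + 1 = (2::nat) ^ c + 2 ^ e"
      using eq' Suc \<open>a = 0\<close> \<open>s = 0\<close> q by simp
    have "c = 0 \<or> e = 0"
    proof (rule ccontr)
      assume "\<not> (c = 0 \<or> e = 0)"
      then have "even ((2::nat) ^ c + 2 ^ e)" by simp
      then show False using sum p by (metis \<open>odd q\<close> q)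
    qed
    then have "c = 0 \<and> e = p \<or> c = p \<and> e = 0" using sum by auto
    then show ?thesis using \<open>d = f\<close> b Suc \<open>a = 0\<close> \<open>s = 0\<close> by simp
  qed
qed

text \<open>Here \<open>N\<close> stands for \<open>n - 1\<close>. Division by \<open>N\<close>
  yields the block and the position in it, so a vertex shared by two blocks counts as position 0 of
  the later one.\<close>

definition snake_label :: "nat \<Rightarrow> nat \<Rightarrow> nat" where
  "snake_label N i = 2 ^ (i mod N) * (2 ^ (N - 1) + 1) ^ (i div N)"

lemma snake_label_pos: "0 < snake_label N i"
  by (simp add: snake_label_def)

text \<open>Within a block the sum is a doubling, a step along the path. Otherwise the summands are
  the first and last positions of a block: if \<open>j\<close> is the first, this is the chord; if
  the last, the path edge into the next block.\<close>

lemma snake_label_eq_sum: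
  assumes N: "N \<ge> 2" and eq: "snake_label N i = snake_label N j + snake_label N k"
  shows "i = Suc j \<or> (\<exists>d. j = d * N \<and> i = Suc d * N)"
proof -
  have le: "m mod N \<le> N - 1" for m using N mod_less_divisor[of N m] by linarith
  have p: "N - 1 \<ge> 1" using N by simp
  have ij: "i = i div N * N + i mod N" "j = j div N * N + j mod N" by simp_all
  have "i div N = j div N \<and> i mod N = Suc (j mod N) \<or>
      i div N = Suc (j div N) \<and> i mod N = 0 \<and> (j mod N = 0 \<or> j mod N = N - 1)"
    using power_product_eq_sum[OF p refl le le eq[unfolded snake_label_def] le] by blast
  then show ?thesis
  proof (elim disjE conjE)
    assume "i div N = j div N" "i mod N = Suc (j mod N)"
    then show ?thesis using ij by (metis add_Suc_right)
  next
    assume "i div N = Suc (j div N)" "i mod N = 0" "j mod N = 0"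
    then show ?thesis using ij by (metis add_0_right)
  next
    assume "i div N = Suc (j div N)" "i mod N = 0" "j mod N = N - 1"
    then have "i = Suc j" using ij N by simp
    then show ?thesis ..
  qed
qed

lemma snake_label_chord:
  assumes "N \<ge> 2"
  shows "snake_label N (Suc d * N) = snake_label N (d * N) + snake_label N (d * N + (N - 1))"
proof -
  have "(d * N + (N - 1)) div N = d" "(d * N + (N - 1)) mod N = N - 1"
    using assms div_mult_self3[of N d "N - 1"] mod_mult_self3[of d N "N - 1"] by auto
  then show ?thesis
    using assms unfolding snake_label_def by (simp del: mult_Suc One_nat_def add: distrib_right)
qed

text \<open>Inside a block the witness is \<open>i\<close> itself, by doubling. At the last position
  it is the first vertex of the block, by the chord relation with its summands exchanged. The bound
  on \<open>k\<close> keeps the witness inside the snake.\<close>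

lemma snake_label_Suc:
  assumes N: "N \<ge> 2"
  shows "\<exists>k\<le>i. snake_label N (Suc i) = snake_label N i + snake_label N k"
proof (cases "Suc (i mod N) = N")
  case True
  have i: "i = i div N * N + (N - 1)"
    using True by (metis diff_Suc_1 div_mult_mod_eq)
  then have "Suc i = Suc (i div N) * N" using N by simp
  then have "snake_label N (Suc i) = snake_label N (i div N * N) + snake_label N i"
    using snake_label_chord[OF N, of "i div N"] i by metis
  then show ?thesis
    by (intro exI[of _ "i div N * N"]) simp
next
  case False
  then have "Suc i div N = i div N" "Suc i mod N = Suc (i mod N)"
    by (simp_all add: div_Suc mod_Suc)
  then have "snake_label N (Suc i) = snake_label N i + snake_label N i"
    by (simp add: snake_label_def)
  then show ?thesis by blast
qed

lemma strict_mono_snake_label: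
  assumes "N \<ge> 2"
  shows "strict_mono (snake_label N)"
proof (unfold strict_mono_Suc_iff, rule allI)
  fix i
  show "snake_label N i < snake_label N (Suc i)"
    using snake_label_Suc[OF assms, of i] snake_label_pos[of N] by (metis less_add_same_cancel1)
qed

lemma snake_edge_iff:
  assumes "n \<ge> 3" "j < i" "i \<le> K * (n - 1)"
  shows "{i, j} \<in> snake_edges n K \<longleftrightarrow>
    (\<exists>k\<le>K * (n - 1). snake_label (n - 1) i = snake_label (n - 1) j + snake_label (n - 1) k)"
    (is "_ \<longleftrightarrow> ?sum")
proof -
  have N: "n - 1 \<ge> 2" using assms by simp
  show ?thesis
  proof
    assume "{i, j} \<in> snake_edges n K"
    then consider "i = Suc j" | d where "d < K" "j = d * (n - 1)" "i = Suc d * (n - 1)"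
      using assms by (auto simp: snake_edges_def doubleton_eq_iff)
    then show ?sum
    proof cases
      case 1
      then show ?thesis using snake_label_Suc[OF N, of j] assms by (metis le_trans less_imp_le)
    next
      case 2
      have "d * (n - 1) + (n - 1 - 1) \<le> Suc d * (n - 1)" by simp
      also have "\<dots> \<le> K * (n - 1)" using 2 assms by simp
      finally have "d * (n - 1) + (n - 1 - 1) \<le> K * (n - 1)" .
      then show ?thesis using snake_label_chord[OF N, of d] 2 by metis
    qed
  next
    assume ?sum
    then consider "i = Suc j" | d where "j = d * (n - 1)" "i = Suc d * (n - 1)"
      using snake_label_eq_sum[OF N] by blast
    then show "{i, j} \<in> snake_edges n K"
    proof cases
      case 1
      then have "{i, j} = {j, j + 1}" "j < K * (n - 1)" using assms by auto
      then show ?thesis unfolding snake_edges_def by blast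
    next
      case 2
      \<comment> \<open>That the chord lies in one of the \<open>K\<close> blocks follows from the
        bound on \<open>i\<close>.\<close>
      have "Suc d \<le> K" using assms(1,3) 2(2) by (simp only: mult_le_cancel2)
      then have "{i, j} = {d * (n - 1), (d + 1) * (n - 1)}" "d < K" using 2 by auto
      then show ?thesis unfolding snake_edges_def by blast
    qed
  qed
qed

theorem theorem3p8:
  fixes n K :: nat
  assumes "n \<ge> 3" and "K \<ge> 1"
  shows "difference_graph (snake_verts n K) (snake_edges n K)"
proof -
  define l where "l = snake_label (n - 1)"
  define f where "f i = int (l i)" for i
  let ?V = "snake_verts n K"
  have mono: "strict_mono l"
    using strict_mono_snake_label[of "n - 1"] assms by (simp add: l_def)
  have "simple_graph ?V (snake_edges n K)"
    unfolding simple_graph_def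
  proof
    fix e assume "e \<in> snake_edges n K"
    then consider i where "e = {i, i + 1}" "i < K * (n - 1)"
      | k where "e = {k * (n - 1), Suc k * (n - 1)}" "k < K"
      by (auto simp: snake_edges_def)
    then show "e \<subseteq> ?V \<and> card e = 2"
    proof cases
      case 1
      then show ?thesis by (auto simp: snake_verts_def)
    next
      case 2
      then have "Suc k * (n - 1) \<le> K * (n - 1)" by (intro mult_right_mono) auto
      then show ?thesis using 2 assms by (auto simp: snake_verts_def)
    qed
  qed
  moreover have "f ` ?V \<subseteq> {0<..}"
    by (auto simp: f_def l_def snake_label_pos)
  moreover have "bij_betw f ?V (f ` ?V)"
    using strict_mono_imp_inj_on[OF mono] by (auto simp: bij_betw_def inj_on_def f_def)
  moreover have "{x, y} \<in> snake_edges n K \<longleftrightarrow> \<bar>f x - f y\<bar> \<in> f ` ?V"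
    if "x \<in> ?V" "y \<in> ?V" "x \<noteq> y" for x y
  proof -
    \<comment> \<open>Both sides are symmetric, so the larger index may come first; monotonicity
      then removes the absolute value.\<close>
    have *: "{i, j} \<in> snake_edges n K \<longleftrightarrow> \<bar>f i - f j\<bar> \<in> f ` ?V"
      if "i \<in> ?V" "j < i" for i j
    proof -
      have "l j < l i" using mono \<open>j < i\<close> by (simp add: strict_mono_less)
      then have "\<bar>f i - f j\<bar> = f k \<longleftrightarrow> l i = l j + l k" for k by (auto simp: f_def)
      then have "\<bar>f i - f j\<bar> \<in> f ` ?V \<longleftrightarrow> (\<exists>k\<le>K * (n - 1). l i = l j + l k)"
        by (auto simp: image_iff snake_verts_def)
      then show ?thesis
        using snake_edge_iff[of n j i K] assms that by (simp add: l_def snake_verts_def)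
    qed
    show ?thesis
      using *[of x y] *[of y x] that by (metis abs_minus_commute insert_commute linorder_neqE_nat)
  qed
  ultimately show ?thesis unfolding difference_graph_def by blast
qed

end
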